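(* A respectful linear multibracket with signature $\mathcal A=\mathcal A_1\to\cdots\to\mathcal A_k$ is weakly efficient if and only if there is some integer $j$ with $1\le j\le k$ such that every semibracket $\mathcal A_i$ with $i<j$ is trivial and every semibracket $\mathcal A_i$ with $i>j$ is competitive.
   Context: A semibracket of rank $m\ge1$ is a collection (forest) of $m$ full binary trees (children unordered). Leaves are starting lines; each internal node is a game between the teams arriving from its two children; the winner moves up, the loser plays no more games in the semibracket; the $m$ teams reaching the roots win the semibracket (are its co-champions). If the maximal height is $r$, it has $r$ rounds: games at distance $d$ from a root form round $r-d$, and a leaf at distance $d$ from its root has $r-d$ byes. Its signature is $[[a_0;\dots;a_r]]_m$ with $a_i$ the number of leaves with $i$ byes. A semibracket is trivial if every team in it is declared co-champion without playing any games (signature $[[m]]_m$), and competitive if no team is declared co-champion without winning at least one game in it (its signature ends in $0$). A linear multibracket on teams $t_1,\dots,t_n$ (smaller index = higher seed) is a sequence of semibrackets $\mathcal A_1,\dots,\mathcal A_k$ in which every starting line is labelled either by a seed (that team starts there) or by a game (the loser of that game is placed there); no seed or game labels more than one starting line; and a team that loses in a given semibracket and is not eliminated is sent to a later semibracket. Losers of games that label no line are eliminated and finish unranked. Each team that wins $\mathcal A_i$ finishes in $m$th place, where $m$ is the sum of the ranks of $\mathcal A_1,\dots,\mathcal A_i$ (such teams are ranked). The signature of the linear multibracket is the sequence $\mathcal A_1\to\cdots\to\mathcal A_k$ of the signatures of its semibrackets. The flowchart of a linear multibracket with $k$ semibrackets is a directed graph drawn with its nodes arranged into rows, from top to bottom.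 There is a node for each team, each round of each semibracket, and each place a team could finish in, plus one additional node representing elimination. Row $0$ has the nodes for the teams, arranged from lowest seed to highest seed; row $i$, for $1\le i\le k$, has the nodes for the rounds of the $i$th semibracket, arranged in order, plus the node for the place a team gets for winning the $i$th semibracket; the final row has only the elimination node. There is an arrow from each team to the round where it plays its first game, and for each round $R$ there is an arrow (or arrows) from $R$ to the round(s) where the losers of $R$ go (to a place node if they win a semibracket without playing another game, or to the elimination node if they are eliminated; likewise a team that wins a semibracket without playing has an arrow to that place node). A linear multibracket is respectful if its flowchart has no arrow crossings and every node in its flowchart has at most one arrow coming out of it. (To prevent arrows from being routed around the outside of the drawing, one imagines arrows extending infinitely up from the team nodes, infinitely to the right from the place nodes, and infinitely down from the elimination node.) A multibracket is weakly efficient if, once a team is guaranteed to be ranked by the format or guaranteed to finish unranked, it stops playing games.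
   Formalization: Respectful is tightened: arrows run downward, and one passing a semibracket's row must stay left of its last round, not merely of its place node; otherwise A_1 = game t_2–t_3 (loser eliminated), A_2 = [[1]]_1 holding t_1 refutes the claim. *)

theory Defs
  imports Complex_Main
begin

text \<open>Full binary trees. The order of the two children only serves to name them; nothing below
  depends on it.\<close>

datatype 'a btree = Leaf 'a | Node "'a btree" "'a btree"

fun height :: "'a btree \<Rightarrow> nat" where
  "height (Leaf a) = 0"
| "height (Node l r) = Suc (max (height l) (height r))"

fun subtree :: "'a btree \<Rightarrow> bool list \<Rightarrow> 'a btree option" where
  "subtree t [] = Some t"
| "subtree (Leaf a) (b # p) = None"
| "subtree (Node l r) (b # p) = subtree (if b then r else l) p"

fun leaf_depths :: "'a btree \<Rightarrow> nat list" where
  "leaf_depths (Leaf a) = [0]"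
| "leaf_depths (Node l r) = map Suc (leaf_depths l @ leaf_depths r)"


subsection \<open>Semibrackets\<close>

text \<open>A semibracket is a nonempty list of trees; its rank is the length of the list.\<close>

type_synonym 'a semibracket = "'a btree list"

definition rounds :: "'a semibracket \<Rightarrow> nat" where
  "rounds B = Max (height ` set B)"

text \<open>The list of the \<open>a\<^sub>0, \<dots>, a\<^sub>r\<close>, where \<open>a\<^sub>i\<close> counts the leaves with \<open>i\<close> byes.\<close>

definition signature :: "'a semibracket \<Rightarrow> nat list" where
  "signature B = map (\<lambda>i. length (filter (\<lambda>d. rounds B - d = i) (concat (map leaf_depths B))))
     [0..<Suc (rounds B)]"

definition trivial :: "'a semibracket \<Rightarrow> bool" where
  "trivial B \<longleftrightarrow> (\<forall>t\<in>set B. \<exists>a. t = Leaf a)"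

definition competitive :: "'a semibracket \<Rightarrow> bool" where
  "competitive B \<longleftrightarrow> (\<forall>t\<in>set B. \<not> (\<exists>a. t = Leaf a))"

lemma height_eq_0_iff: "height t = 0 \<longleftrightarrow> (\<exists>a. t = Leaf a)"
  by (cases t) auto

lemma leaf_depth_le_height: "d \<in> set (leaf_depths t) \<Longrightarrow> d \<le> height t"
  by (induction t arbitrary: d) fastforce+

lemma zero_leaf_depth_iff: "0 \<in> set (leaf_depths t) \<longleftrightarrow> (\<exists>a. t = Leaf a)"
  by (cases t) auto

lemma rounds_eq_0_iff:
  assumes "B \<noteq> []"
  shows "rounds B = 0 \<longleftrightarrow> trivial B"
proof -
  have "rounds B = 0 \<longleftrightarrow> (\<forall>t\<in>set B. height t \<le> 0)"
    unfolding rounds_def using assms Max_le_iff[of "height ` set B" 0] by auto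
  then show ?thesis by (simp add: trivial_def height_eq_0_iff)
qed

lemma trivial_iff_signature:
  assumes "B \<noteq> []"
  shows "trivial B \<longleftrightarrow> signature B = [length B]"
proof
  assume *: "trivial B"
  have "concat (map leaf_depths B) = map (\<lambda>_. 0) B"
    using * by (induction B) (auto simp: trivial_def)
  moreover have "rounds B = 0" using * rounds_eq_0_iff[OF assms] by simp
  ultimately show "signature B = [length B]"
    by (simp add: signature_def)
next
  assume "signature B = [length B]"
  then have "length (signature B) = 1" by simp
  then have "rounds B = 0" by (simp add: signature_def)
  then show "trivial B" using rounds_eq_0_iff[OF assms] by simp
qed

lemma competitive_iff_signature:
  assumes "B \<noteq> []"
  shows "competitive B \<longleftrightarrow> last (signature B) = 0"
proof -
  have le: "height t \<le> rounds B" if "t \<in> set B" for t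
    using that by (simp add: rounds_def)
  have "last (signature B) = 0 \<longleftrightarrow>
      (\<forall>t\<in>set B. \<forall>d\<in>set (leaf_depths t). rounds B - d \<noteq> rounds B)"
    by (auto simp: signature_def filter_empty_conv)
  also have "\<dots> \<longleftrightarrow> (\<forall>t\<in>set B. 0 \<notin> set (leaf_depths t))"
  proof (cases "rounds B = 0")
    case True
    then have "leaf_depths t = [0]" if "t \<in> set B" for t
      using le[OF that] height_eq_0_iff[of t] by auto
    then show ?thesis using True by auto
  next
    case False
    then show ?thesis by (metis diff_is_0_eq diff_less diff_zero gr0I less_irrefl)
  qed
  also have "\<dots> \<longleftrightarrow> competitive B"
    by (simp add: competitive_def zero_leaf_depth_iff)
  finally show ?thesis by simp
qed


subsection \<open>Linear multibrackets\<close>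

text \<open>The position \<open>(i, q, p)\<close> is the node reached along the path \<open>p\<close> from the root of the \<open>q\<close>-th tree
  (counted from 0) of the \<open>i\<close>-th semibracket (counted from 1). Internal positions are the games.
  Seed \<open>s\<close> is the team \<open>t\<^sub>s\<close>.\<close>

type_synonym position = "nat \<times> nat \<times> bool list"

datatype label = Seed nat | Loser position

type_synonym multibracket = "label semibracket list"

abbreviation nth_semibracket :: "multibracket \<Rightarrow> nat \<Rightarrow> label semibracket" where
  "nth_semibracket M i \<equiv> M ! (i - 1)"

fun node_at :: "multibracket \<Rightarrow> position \<Rightarrow> label btree option" where
  "node_at M (i, q, p) =
     (if 1 \<le> i \<and> i \<le> length M \<and> q < length (nth_semibracket M i)
      then subtree (nth_semibracket M i ! q) p else None)"

definition is_game :: "multibracket \<Rightarrow> position \<Rightarrow> bool" where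
  "is_game M g \<longleftrightarrow> (\<exists>l r. node_at M g = Some (Node l r))"

definition starting_line :: "multibracket \<Rightarrow> position \<Rightarrow> label \<Rightarrow> bool" where
  "starting_line M v a \<longleftrightarrow> node_at M v = Some (Leaf a)"

fun child :: "position \<Rightarrow> bool \<Rightarrow> position" where
  "child (i, q, p) b = (i, q, p @ [b])"

definition linear_multibracket :: "nat \<Rightarrow> multibracket \<Rightarrow> bool" where
  "linear_multibracket n M \<longleftrightarrow>
     M \<noteq> [] \<and> [] \<notin> set M \<and>
     (\<forall>v s. starting_line M v (Seed s) \<longrightarrow> 1 \<le> s \<and> s \<le> n) \<and>
     (\<forall>v g. starting_line M v (Loser g) \<longrightarrow> is_game M g \<and> fst g < fst v) \<and>
     (\<forall>v w a. starting_line M v a \<and> starting_line M w a \<longrightarrow> v = w)"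


subsection \<open>Flowcharts\<close>

text \<open>\<open>Place i\<close> is the place awarded for winning the \<open>i\<close>-th semibracket.\<close>

datatype flow_node = Team nat | Round nat nat | Place nat | Elimination

definition flow_nodes :: "nat \<Rightarrow> multibracket \<Rightarrow> flow_node set" where
  "flow_nodes n M = Team ` {1..n}
     \<union> {Round i c | i c. 1 \<le> i \<and> i \<le> length M \<and> 1 \<le> c \<and> c \<le> rounds (nth_semibracket M i)}
     \<union> Place ` {1..length M} \<union> {Elimination}"

fun row :: "multibracket \<Rightarrow> flow_node \<Rightarrow> nat" where
  "row M (Team s) = 0"
| "row M (Round i c) = i"
| "row M (Place i) = i"
| "row M Elimination = Suc (length M)"

text \<open>Left-to-right order within a row; lower seeds (larger indices) are further left.\<close>

fun left_of :: "flow_node \<Rightarrow> flow_node \<Rightarrow> bool" where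
  "left_of (Team s) (Team s') \<longleftrightarrow> s > s'"
| "left_of (Round i c) (Round i' c') \<longleftrightarrow> i = i' \<and> c < c'"
| "left_of (Round i c) (Place i') \<longleftrightarrow> i = i'"
| "left_of _ _ \<longleftrightarrow> False"

fun game_round :: "multibracket \<Rightarrow> position \<Rightarrow> flow_node" where
  "game_round M (i, q, p) = Round i (rounds (nth_semibracket M i) - length p)"

text \<open>Where a team placed on the given starting line shows up in the flowchart. The first game of a
  leaf at distance \<open>d > 0\<close> from its root is at distance \<open>d - 1\<close>.\<close>

fun entry :: "multibracket \<Rightarrow> position \<Rightarrow> flow_node" where
  "entry M (i, q, p) = (if p = [] then Place i else game_round M (i, q, butlast p))"

inductive_set arrows :: "multibracket \<Rightarrow> (flow_node \<times> flow_node) set" for M where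
  team: "starting_line M v (Seed s) \<Longrightarrow> (Team s, entry M v) \<in> arrows M"
| loser: "is_game M g \<Longrightarrow> starting_line M v (Loser g) \<Longrightarrow>
    (game_round M g, entry M v) \<in> arrows M"
| eliminated: "is_game M g \<Longrightarrow> \<not> (\<exists>v. starting_line M v (Loser g)) \<Longrightarrow>
    (game_round M g, Elimination) \<in> arrows M"

text \<open>The drawing puts the node \<open>u\<close> at horizontal coordinate \<open>X u\<close> and depth \<open>row M u\<close>. Arrows run
  downwards: the arrow \<open>e\<close> is the curve that has horizontal coordinate \<open>C e y\<close> at depth \<open>y\<close>.\<close>

definition drawing ::
  "nat \<Rightarrow> multibracket \<Rightarrow> (flow_node \<Rightarrow> real) \<Rightarrow> (flow_node \<times> flow_node \<Rightarrow> real \<Rightarrow> real) \<Rightarrow> bool" where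
  "drawing n M X C \<longleftrightarrow>
     (\<forall>u\<in>flow_nodes n M. \<forall>v\<in>flow_nodes n M. left_of u v \<longrightarrow> X u < X v) \<and>
     (\<forall>(u, v)\<in>arrows M. continuous_on {real (row M u)..real (row M v)} (C (u, v)) \<and>
        C (u, v) (real (row M u)) = X u \<and> C (u, v) (real (row M v)) = X v)"

text \<open>The node of row \<open>i\<close> from which a barrier runs infinitely to the right, which no arrow passing
  through that row may cross. This is the last round, if there is one: its winners move on to the
  place node, and the arrow going right from the place node continues that link.
  If arrows were allowed to slip in between the last round and the place node, then a
  top seed could be sent past the first semibracket directly to second place.
  The arrows going up from the teams and down from the elimination node need no such condition,
  since no arrow leaves the strip between row 0 and the last row.\<close>

definition row_end :: "multibracket \<Rightarrow> nat \<Rightarrow> flow_node" where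
  "row_end M i = (if rounds (nth_semibracket M i) = 0 then Place i
                  else Round i (rounds (nth_semibracket M i)))"

definition no_crossings ::
  "nat \<Rightarrow> multibracket \<Rightarrow> (flow_node \<Rightarrow> real) \<Rightarrow> (flow_node \<times> flow_node \<Rightarrow> real \<Rightarrow> real) \<Rightarrow> bool" where
  "no_crossings n M X C \<longleftrightarrow>
     \<comment> \<open>two arrows meet only at a common end\<close>
     (\<forall>(u, v)\<in>arrows M. \<forall>(u', v')\<in>arrows M. (u, v) \<noteq> (u', v') \<longrightarrow>
        (\<forall>y \<in> {real (row M u)..real (row M v)} \<inter> {real (row M u')..real (row M v')}.
           C (u, v) y = C (u', v') y \<longrightarrow> (\<exists>w \<in> {u, v} \<inter> {u', v'}. y = real (row M w)))) \<and>
     \<comment> \<open>no arrow runs through a node or crosses the barrier of a row\<close>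
     (\<forall>(u, v)\<in>arrows M. \<forall>i. row M u < i \<and> i < row M v \<longrightarrow>
        (\<forall>w\<in>flow_nodes n M. row M w = i \<longrightarrow> C (u, v) (real i) \<noteq> X w) \<and>
        C (u, v) (real i) < X (row_end M i))"

definition respectful :: "nat \<Rightarrow> multibracket \<Rightarrow> bool" where
  "respectful n M \<longleftrightarrow>
     (\<forall>u v w. (u, v) \<in> arrows M \<and> (u, w) \<in> arrows M \<longrightarrow> v = w) \<and>
     (\<exists>X C. drawing n M X C \<and> no_crossings n M X C)"


subsection \<open>Weak efficiency\<close>

text \<open>An outcome fixes the result of every game: the team coming from \<open>child g (\<omega> g)\<close> wins \<open>g\<close>.\<close>

type_synonym outcome = "position \<Rightarrow> bool"

text \<open>\<open>reaches M \<omega> s v H\<close>: under \<open>\<omega>\<close>, team \<open>s\<close> gets to position \<open>v\<close> (it is placed on the starting line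
  \<open>v\<close>, or has just won the game \<open>v\<close>), and \<open>H\<close> is the set of games it has played so far.\<close>

inductive reaches :: "multibracket \<Rightarrow> outcome \<Rightarrow> nat \<Rightarrow> position \<Rightarrow> position set \<Rightarrow> bool"
  for M \<omega> s where
  start: "starting_line M v (Seed s) \<Longrightarrow> reaches M \<omega> s v {}"
| win: "is_game M g \<Longrightarrow> reaches M \<omega> s (child g b) H \<Longrightarrow> \<omega> g = b \<Longrightarrow>
    reaches M \<omega> s g (insert g H)"
| lose: "is_game M g \<Longrightarrow> reaches M \<omega> s (child g b) H \<Longrightarrow> \<omega> g \<noteq> b \<Longrightarrow>
    starting_line M v (Loser g) \<Longrightarrow> reaches M \<omega> s v (insert g H)"

definition finishes_in_place :: "multibracket \<Rightarrow> outcome \<Rightarrow> nat \<Rightarrow> nat \<Rightarrow> bool" where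
  "finishes_in_place M \<omega> s m \<longleftrightarrow>
     (\<exists>i q H. reaches M \<omega> s (i, q, []) H \<and> m = (\<Sum>h=1..i. length (nth_semibracket M h)))"

definition ranked :: "multibracket \<Rightarrow> outcome \<Rightarrow> nat \<Rightarrow> bool" where
  "ranked M \<omega> s \<longleftrightarrow> (\<exists>m. finishes_in_place M \<omega> s m)"

definition guaranteed_ranked :: "multibracket \<Rightarrow> outcome \<Rightarrow> nat \<Rightarrow> position set \<Rightarrow> bool" where
  "guaranteed_ranked M \<omega> s H \<longleftrightarrow> (\<forall>\<omega>'. (\<forall>g\<in>H. \<omega>' g = \<omega> g) \<longrightarrow> ranked M \<omega>' s)"

definition guaranteed_unranked :: "multibracket \<Rightarrow> outcome \<Rightarrow> nat \<Rightarrow> position set \<Rightarrow> bool" where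
  "guaranteed_unranked M \<omega> s H \<longleftrightarrow> (\<forall>\<omega>'. (\<forall>g\<in>H. \<omega>' g = \<omega> g) \<longrightarrow> \<not> ranked M \<omega>' s)"

definition weakly_efficient :: "multibracket \<Rightarrow> bool" where
  "weakly_efficient M \<longleftrightarrow>
     (\<forall>\<omega> s v H. reaches M \<omega> s v H \<and> (guaranteed_ranked M \<omega> s H \<or> guaranteed_unranked M \<omega> s H) \<longrightarrow>
        \<not> (\<exists>g b. is_game M g \<and> v = child g b))"

end

theory Submission
  imports Defs
begin

text \<open>A team about to play can always win its way to a root, so it is never guaranteed to finish
  unranked. If it can be forced to lose its way through competitive semibrackets only, it is not
  guaranteed to be ranked either; this gives one direction.
  Conversely, suppose that \<open>\<A>\<^sub>m\<close> has a single-leaf tree and that \<open>i < m\<close> is maximal with \<open>\<A>\<^sub>i\<close>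
  nontrivial. The arrow filling that leaf passes row \<open>i\<close> no further right than the last round
  of \<open>\<A>\<^sub>i\<close>, so the arrow out of this last round is trapped to its right. As the rows
  between \<open>i\<close> and \<open>m\<close> consist of place nodes, the trapped arrow ends at a place node. Hence the
  finalists of \<open>\<A>\<^sub>i\<close> are guaranteed to be ranked, but still play.\<close>

section \<open>Positions\<close>

lemma subtree_append: "subtree t (p @ q) = Option.bind (subtree t p) (\<lambda>u. subtree u q)"
  by (induction t p rule: subtree.induct) auto

lemma subtree_height: "subtree t p = Some u \<Longrightarrow> length p + height u \<le> height t"
  by (induction t p rule: subtree.induct) (auto split: if_splits)

lemma child_inject [simp]: "child g b = child g' b' \<longleftrightarrow> g = g' \<and> b = b'"
  by (cases g; cases g') auto

lemma child_neq_root [simp]: "child g b \<noteq> (i, q, [])" "(i, q, []) \<noteq> child g b"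
  by (cases g; simp)+

lemma fst_child [simp]: "fst (child g b) = fst g"
  by (cases g) auto

lemma length_child [simp]: "length (snd (snd (child g b))) = Suc (length (snd (snd g)))"
  by (cases g) auto

lemma node_at_child:
  assumes "node_at M g = Some (Node l r)"
  shows "node_at M (child g b) = Some (if b then r else l)"
  using assms by (cases g) (auto simp: subtree_append split: if_splits)

lemma is_game_parent:
  assumes "node_at M (child g b) = Some t"
  shows "is_game M g"
proof -
  obtain i q p where g: "g = (i, q, p)" by (cases g)
  from assms obtain u where u: "node_at M g = Some u" "subtree u [b] = Some t"
    by (auto simp: g subtree_append split: if_splits bind_splits)
  then show ?thesis by (cases u) (auto simp: is_game_def)
qed

lemma non_root_is_child:
  assumes "p \<noteq> []"
  obtains b where "(i, q, p) = child (i, q, butlast p) b"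
  using assms by (metis append_butlast_last_id child.simps)

lemma node_at_height:
  assumes "node_at M (i, q, p) = Some u"
  shows "1 \<le> i" "i \<le> length M" "length p + height u \<le> rounds (nth_semibracket M i)"
proof -
  have *: "1 \<le> i" "i \<le> length M" "q < length (nth_semibracket M i)"
    and u: "subtree (nth_semibracket M i ! q) p = Some u"
    using assms by (auto split: if_splits)
  have "height (nth_semibracket M i ! q) \<le> rounds (nth_semibracket M i)"
    unfolding rounds_def using *(3) by (intro Max_ge) auto
  with subtree_height[OF u] show "length p + height u \<le> rounds (nth_semibracket M i)" by simp
  show "1 \<le> i" "i \<le> length M" by fact+
qed

text \<open>The strict bound keeps the natural-number subtraction in \<open>game_round\<close> from
  truncating, so every game lies in a round numbered at least 1.\<close>

lemma is_game_bounds: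
  assumes "is_game M (i, q, p)"
  shows "1 \<le> i" "i \<le> length M" "length p < rounds (nth_semibracket M i)"
proof -
  obtain l r where lr: "node_at M (i, q, p) = Some (Node l r)"
    using assms unfolding is_game_def by blast
  from node_at_height[OF lr]
  show "1 \<le> i" "i \<le> length M" "length p < rounds (nth_semibracket M i)" by auto
qed

lemma trivial_no_game:
  assumes "trivial (nth_semibracket M (fst g))"
  shows "\<not> is_game M g"
proof
  assume g: "is_game M g"
  obtain i q p where gi: "g = (i, q, p)" by (cases g)
  from g have q: "q < length (nth_semibracket M i)"
    by (auto simp: gi is_game_def split: if_splits)
  then have "nth_semibracket M i \<noteq> []" by auto
  then have "rounds (nth_semibracket M i) = 0"
    using assms rounds_eq_0_iff[of "nth_semibracket M i"] by (simp add: gi)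
  with is_game_bounds(3)[of M i q p] g show False by (simp add: gi)
qed


section \<open>The course of a team\<close>

text \<open>Each step of a derivation consults the outcome only at a game that enters the history.
  Results of games not yet played can therefore be changed at will.\<close>

lemma reaches_cong:
  assumes "reaches M \<omega> s v H" "\<forall>g\<in>H. \<omega>' g = \<omega> g"
  shows "reaches M \<omega>' s v H"
  using assms
proof induction
  case (start v)
  show ?case by (rule reaches.start[OF start(1)])
next
  case (win g b H)
  then show ?case by (auto intro: reaches.win)
next
  case (lose g b H v)
  then show ?case by (auto intro: reaches.lose)
qed

lemma loser_line:
  assumes "linear_multibracket n M" "starting_line M v (Loser g)"
  shows "is_game M g" "fst g < fst v"
  using assms unfolding linear_multibracket_def by blast+

lemma starting_line_unique:
  assumes "linear_multibracket n M" "starting_line M v a" "starting_line M w a"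
  shows "v = w"
  using assms unfolding linear_multibracket_def by blast

lemma nth_semibracket_nonempty:
  assumes "linear_multibracket n M" "1 \<le> i" "i \<le> length M"
  shows "nth_semibracket M i \<noteq> []"
proof -
  have "nth_semibracket M i \<in> set M" using assms(2,3) by (intro nth_mem) simp
  then show ?thesis using assms(1) unfolding linear_multibracket_def by metis
qed

text \<open>A monovariant: winning moves a team closer to a root of the same semibracket, losing
  moves it to a later one. It excludes meeting a game twice, so the result of a team's next game is
  always still free.\<close>

lemma reaches_played_before:
  assumes lin: "linear_multibracket n M"
    and "reaches M \<omega> s v H" "h \<in> H"
  shows "fst h < fst v \<or> fst h = fst v \<and> length (snd (snd v)) \<le> length (snd (snd h))"
  using assms(2,3)
proof (induction arbitrary: h)
  case (start v)
  then show ?case by simp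
next
  case (win g b H)
  then have "h = g \<or> h \<in> H" by blast
  then show ?case using win.IH[of h] by (elim disjE) (simp, force)
next
  case (lose g b H v)
  then have "h = g \<or> h \<in> H" "fst g < fst v" using loser_line(2)[OF lin] by blast+
  then show ?case using lose.IH[of h] by (elim disjE) (simp, force)
qed

lemma next_game_not_played:
  assumes "linear_multibracket n M" "reaches M \<omega> s (child g b) H"
  shows "g \<notin> H"
  using reaches_played_before[OF assms, of g] by auto

text \<open>\<open>reaches\<close> recast as a step relation on configurations (position, history).
  In this form the uniqueness of a team's fate follows from confluence of a single-valued
  relation.\<close>

definition course :: "multibracket \<Rightarrow> outcome \<Rightarrow> ((position \<times> position set) rel)" where
  "course M \<omega> = {((child g b, H), (w, insert g H)) | g b H w.
     is_game M g \<and> (\<omega> g = b \<and> w = g \<or> \<omega> g \<noteq> b \<and> starting_line M w (Loser g))}"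

lemma single_valued_course:
  assumes "linear_multibracket n M"
  shows "single_valued (course M \<omega>)"
proof (rule single_valuedI)
  fix x y z
  assume "(x, y) \<in> course M \<omega>" "(x, z) \<in> course M \<omega>"
  then show "y = z"
    unfolding course_def using starting_line_unique[OF assms] by clarsimp metis
qed

lemma reaches_course:
  assumes "reaches M \<omega> s v H"
  shows "\<exists>v0. starting_line M v0 (Seed s) \<and> ((v0, {}), (v, H)) \<in> (course M \<omega>)\<^sup>*"
  using assms
proof induction
  case (start v)
  then show ?case by blast
next
  case (win g b H)
  then have "((child g b, H), (g, insert g H)) \<in> course M \<omega>"
    unfolding course_def by blast
  with win.IH show ?case by (meson rtrancl.rtrancl_into_rtrancl)
next
  case (lose g b H v)
  then have "((child g b, H), (v, insert g H)) \<in> course M \<omega>"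
    unfolding course_def by blast
  with lose.IH show ?case by (meson rtrancl.rtrancl_into_rtrancl)
qed

text \<open>With the outcome fixed, a team has only one course. Elimination and arrival at a root
  both end it, so they cannot both happen.\<close>

lemma eliminated_not_ranked:
  assumes lin: "linear_multibracket n M"
    and r: "reaches M \<omega> s (child g b) H" and w: "\<omega> g \<noteq> b"
    and el: "\<not> (\<exists>v. starting_line M v (Loser g))"
  shows "\<not> ranked M \<omega> s"
proof
  assume "ranked M \<omega> s"
  then obtain i q K where r': "reaches M \<omega> s (i, q, []) K"
    unfolding ranked_def finishes_in_place_def by blast
  obtain v0 where v0: "starting_line M v0 (Seed s)"
    and c: "((v0, {}), (child g b, H)) \<in> (course M \<omega>)\<^sup>*" using reaches_course[OF r] by blast
  obtain v1 where v1: "starting_line M v1 (Seed s)"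
    and c': "((v1, {}), ((i, q, []), K)) \<in> (course M \<omega>)\<^sup>*" using reaches_course[OF r'] by blast
  have "v1 = v0" by (rule starting_line_unique[OF lin v1 v0])
  \<comment> \<open>Both configurations lie on the deterministic course from the same starting line,
    so one of them leads to the other.\<close>
  with single_valued_confluent[OF single_valued_course[OF lin] c] c'
  have "((child g b, H), ((i, q, []), K)) \<in> (course M \<omega>)\<^sup>* \<or>
      (((i, q, []), K), (child g b, H)) \<in> (course M \<omega>)\<^sup>*" by blast
  \<comment> \<open>Neither configuration has a successor: the loser of \<open>g\<close> has no line
    to go to, and a root is no child of a game. Hence they would have to be equal, but a root is not
    a child position.\<close>
  moreover have "((child g b, H), x) \<notin> course M \<omega>" for x
    using w el by (simp add: course_def del: split_paired_Ex split_paired_All)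
  moreover have "(((i, q, []), K), x) \<notin> course M \<omega>" for x
    by (simp add: course_def del: split_paired_Ex split_paired_All)
  ultimately show False by (metis child_neq_root(1) converse_rtranclE fst_conv)
qed

section \<open>Completing a partial outcome: winning out, losing out, reachability\<close>

lemma reaches_root_ranked: "reaches M \<omega> s (i, q, []) H \<Longrightarrow> ranked M \<omega> s"
  unfolding ranked_def finishes_in_place_def by blast

text \<open>Decide every game on the path up to the root in favour of the team. None of them belongs
  to the history, so the changes never contradict the results fixed so far.\<close>

lemma can_win_out:
  assumes lin: "linear_multibracket n M"
    and "reaches M \<omega> s (i, q, p) H" "node_at M (i, q, p) \<noteq> None"
  shows "\<exists>\<omega>'. (\<forall>g\<in>H. \<omega>' g = \<omega> g) \<and> ranked M \<omega>' s"
  using assms(2,3)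
proof (induction p arbitrary: \<omega> H rule: rev_induct)
  case Nil
  then show ?case by (intro exI[of _ \<omega>]) (simp add: reaches_root_ranked)
next
  case (snoc b p)
  let ?g = "(i, q, p)"
  let ?\<omega> = "\<omega>(?g := b)"
  have ch: "(i, q, p @ [b]) = child ?g b" by simp
  obtain u where "node_at M (child ?g b) = Some u" using snoc.prems(2) unfolding ch by blast
  then have g: "is_game M ?g" by (rule is_game_parent)
  have r: "reaches M \<omega> s (child ?g b) H" using snoc.prems(1) unfolding ch .
  have nH: "?g \<notin> H" by (rule next_game_not_played[OF lin r])
  then have "reaches M ?\<omega> s (child ?g b) H" by (intro reaches_cong[OF r]) auto
  then have "reaches M ?\<omega> s ?g (insert ?g H)" using g by (intro reaches.win) auto
  moreover have "node_at M ?g \<noteq> None" using g by (auto simp: is_game_def simp del: node_at.simps)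
  ultimately obtain \<omega>' where \<omega>': "\<forall>g\<in>insert ?g H. \<omega>' g = ?\<omega> g" "ranked M \<omega>' s"
    using snoc.IH[of ?\<omega> "insert ?g H"] by blast
  have "\<omega>' g = \<omega> g" if "g \<in> H" for g
    using that nH \<omega>'(1) by (metis fun_upd_apply insertI2)
  with \<omega>'(2) show ?case by blast
qed

lemma not_guaranteed_unranked:
  assumes "linear_multibracket n M" "reaches M \<omega> s (child g b) H" "is_game M g"
  shows "\<not> guaranteed_unranked M \<omega> s H"
proof -
  obtain i q p where v: "child g b = (i, q, p)" by (metis prod_cases3)
  have "node_at M (child g b) \<noteq> None"
    using assms(3) node_at_child unfolding is_game_def by fastforce
  then show ?thesis
    using can_win_out[OF assms(1), of \<omega> s i q p H] assms(2)
    unfolding v guaranteed_unranked_def by blast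
qed

lemma competitive_line:
  assumes "starting_line M v a" "competitive (nth_semibracket M (fst v))"
  obtains g b where "v = child g b" "is_game M g"
proof -
  obtain i q p where v: "v = (i, q, p)" by (cases v)
  have "p \<noteq> []"
    using assms by (auto simp: v starting_line_def competitive_def split: if_splits)
  then obtain b where b: "v = child (i, q, butlast p) b"
    using non_root_is_child v by metis
  then have "is_game M (i, q, butlast p)"
    using assms(1) is_game_parent unfolding starting_line_def by blast
  with b show ?thesis using that by blast
qed

text \<open>Let the team lose its next game. It is then eliminated or dropped into a later, hence
  competitive, semibracket, where its line is not a root and so there is another game to lose; the
  number of later semibrackets decreases. The first game may still be in semibracket
  \<open>j\<close> itself, because only the destinations of losers need to be competitive.\<close>

lemma can_lose_out:
  assumes lin: "linear_multibracket n M"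
    and comp: "\<And>i. j < i \<Longrightarrow> i \<le> length M \<Longrightarrow> competitive (nth_semibracket M i)"
    and "reaches M \<omega> s (child g b) H" "is_game M g" "j \<le> fst g"
  shows "\<exists>\<omega>'. (\<forall>h\<in>H. \<omega>' h = \<omega> h) \<and> \<not> ranked M \<omega>' s"
  using assms(3-)
proof (induction "length M - fst g" arbitrary: \<omega> g b H rule: less_induct)
  case less
  let ?\<omega> = "\<omega>(g := \<not> b)"
  have nH: "g \<notin> H" by (rule next_game_not_played[OF lin less.prems(1)])
  then have r: "reaches M ?\<omega> s (child g b) H" by (intro reaches_cong[OF less.prems(1)]) auto
  show ?case
  proof (cases "\<exists>v. starting_line M v (Loser g)")
    case False
    then have "\<not> ranked M ?\<omega> s" by (intro eliminated_not_ranked[OF lin r]) auto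
    moreover have "?\<omega> h = \<omega> h" if "h \<in> H" for h using that nH by (metis fun_upd_apply)
    ultimately show ?thesis by blast
  next
    case True
    then obtain v where v: "starting_line M v (Loser g)" by blast
    have lt: "fst g < fst v" by (rule loser_line(2)[OF lin v])
    have le: "fst v \<le> length M"
      using v by (cases v) (auto simp: starting_line_def split: if_splits)
    have "competitive (nth_semibracket M (fst v))" using comp lt le less.prems(3) by simp
    then obtain g' b' where g': "v = child g' b'" "is_game M g'"
      by (rule competitive_line[OF v])
    have "reaches M ?\<omega> s (child g' b') (insert g H)"
      using reaches.lose[OF less.prems(2) r _ v] g'(1) by simp
    moreover have "length M - fst g' < length M - fst g" "j \<le> fst g'"
      using lt le less.prems(3) g'(1) by simp_all
    ultimately obtain \<omega>' where \<omega>': "\<forall>h\<in>insert g H. \<omega>' h = ?\<omega> h" "\<not> ranked M \<omega>' s"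
      using less.hyps[of g' ?\<omega> b' "insert g H"] g'(2) by blast
    have "\<omega>' h = \<omega> h" if "h \<in> H" for h
      using that nH \<omega>'(1) by (metis fun_upd_apply insertI2)
    with \<omega>'(2) show ?thesis by blast
  qed
qed

text \<open>Weak efficiency constrains only positions that some team actually gets to. The induction
  is lexicographic: a game is entered from a child of smaller height, a loser's line from a game in
  an earlier semibracket.\<close>

lemma position_reachable:
  assumes lin: "linear_multibracket n M"
    and "node_at M v = Some t"
  shows "\<exists>\<omega> s H. reaches M \<omega> s v H"
  using assms(2)
proof (induction "(fst v, height t)" arbitrary: v t rule: wf_induct_rule[OF wf_lex_prod[OF wf_less_than wf_less_than]])
  case 1
  \<comment> \<open>As \<open>g\<close> is still unplayed on arrival at its child, its result
    \<open>b\<close> can be prescribed: \<open>True\<close> makes the arriving team win,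
    \<open>False\<close> makes it lose.\<close>
  have via_child: "\<exists>\<omega> s H. reaches M \<omega> s (child g True) H \<and> \<omega> g = b \<and> is_game M g"
    if g: "node_at M g = Some (Node l r)"
      and less: "((fst g, height r), (fst v, height t)) \<in> less_than <*lex*> less_than" for g l r b
  proof -
    have "node_at M (child g True) = Some r" using node_at_child[OF g, of True] by simp
    then obtain \<omega> s H where r: "reaches M \<omega> s (child g True) H"
      using 1(1)[of "child g True" r] less by auto
    have "g \<notin> H" by (rule next_game_not_played[OF lin r])
    then have "reaches M (\<omega>(g := b)) s (child g True) H" by (intro reaches_cong[OF r]) auto
    moreover have "is_game M g" using g unfolding is_game_def by blast
    ultimately show ?thesis by (metis fun_upd_same)
  qed
  show ?case
  proof (cases t)
    case (Node l r)
    then have "((fst v, height r), (fst v, height t)) \<in> less_than <*lex*> less_than" by simp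
    from via_child[OF _ this] 1(2) Node obtain \<omega> s H where
      "reaches M \<omega> s (child v True) H" "\<omega> v = True" "is_game M v" by blast
    then show ?thesis using reaches.win by blast
  next
    case (Leaf a)
    then have line: "starting_line M v a" using 1(2) by (simp add: starting_line_def)
    show ?thesis
    proof (cases a)
      case (Seed s)
      then show ?thesis using line reaches.start by blast
    next
      case (Loser g)
      then have v: "starting_line M v (Loser g)" using line by simp
      obtain l r where "node_at M g = Some (Node l r)"
        using loser_line(1)[OF lin v] unfolding is_game_def by blast
      moreover have "((fst g, height r), (fst v, height t)) \<in> less_than <*lex*> less_than"
        using loser_line(2)[OF lin v] by simp
      ultimately obtain \<omega> s H where
        "reaches M \<omega> s (child g True) H" "\<omega> g = False" "is_game M g"
        using via_child by blast
      then show ?thesis using reaches.lose v by blast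
    qed
  qed
qed


section \<open>Arrows\<close>

lemma entry_cases:
  assumes "starting_line M (i, q, p) a"
  obtains "p = []" "entry M (i, q, p) = Place i" "1 \<le> i" "i \<le> length M"
  | c where "entry M (i, q, p) = Round i c" "Round i c \<in> flow_nodes n M"
proof (cases "p = []")
  case True
  have "node_at M (i, q, p) = Some (Leaf a)" using assms by (simp only: starting_line_def)
  from node_at_height(1,2)[OF this] show ?thesis using that(1) True by simp
next
  case False
  obtain b where b: "(i, q, p) = child (i, q, butlast p) b" by (rule non_root_is_child[OF False])
  have "node_at M (child (i, q, butlast p) b) = Some (Leaf a)"
    using assms unfolding starting_line_def b[symmetric] .
  then have "is_game M (i, q, butlast p)" by (rule is_game_parent)
  from is_game_bounds[OF this]
  have "Round i (rounds (nth_semibracket M i) - length (butlast p)) \<in> flow_nodes n M"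
    unfolding flow_nodes_def by auto
  then show ?thesis using that(2) False by simp
qed

lemma arrow_target_cases:
  assumes "(u, v) \<in> arrows M"
  obtains i where "v = Place i" "1 \<le> i" "i \<le> length M"
  | i c where "v = Round i c" "Round i c \<in> flow_nodes n M"
  | "v = Elimination"
proof -
  have "v = Elimination \<or> (\<exists>w a. v = entry M w \<and> starting_line M w a)"
    using assms by cases blast+
  then consider "v = Elimination"
    | i q p a where "v = entry M (i, q, p)" "starting_line M (i, q, p) a"
    by (metis prod_cases3)
  then show ?thesis
  proof cases
    case 1
    then show ?thesis by (rule that(3))
  next
    case (2 i q p a)
    from 2(2) show ?thesis
    proof (cases rule: entry_cases[where n = n])
      case 1
      then show ?thesis using that(1)[of i] 2(1) by metis
    next
      case (2 c)
      then show ?thesis using that(2)[of i c] \<open>v = entry M (i, q, p)\<close> by metis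
    qed
  qed
qed

lemma game_round_flow_node:
  assumes "is_game M g"
  shows "game_round M g \<in> flow_nodes n M"
  using is_game_bounds[of M "fst g" "fst (snd g)" "snd (snd g)"] assms
  by (cases g) (auto simp: flow_nodes_def)

lemma row_game_round [simp]: "row M (game_round M g) = fst g"
  by (cases g) auto

lemma row_entry [simp]: "row M (entry M v) = fst v"
  by (cases v) auto

lemma arrow_down:
  assumes "linear_multibracket n M" "(u, v) \<in> arrows M"
  shows "row M u < row M v"
  using assms(2)
proof cases
  case (team w s)
  then show ?thesis by (cases w) (auto simp: starting_line_def split: if_splits)
next
  case (loser g w)
  then show ?thesis using loser_line[OF assms(1)] by simp
next
  case (eliminated g)
  then show ?thesis
    using is_game_bounds(2)[of M "fst g" "fst (snd g)" "snd (snd g)"] by (simp add: le_imp_less_Suc)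
qed

lemma arrow_source:
  assumes "(u, v) \<in> arrows M"
  shows "row M u = 0 \<or> (\<exists>g. is_game M g \<and> u = game_round M g)"
  using assms by cases (simp, blast+)

text \<open>The intermediate value theorem applied to the difference of the two curves between rows
  \<open>i\<close> and \<open>m\<close> yields a forbidden crossing.\<close>

lemma no_overtaking:
  assumes dr: "drawing n M X C" and nc: "no_crossings n M X C"
    and e: "(u, v) \<in> arrows M" "row M u \<le> i" "row M v = m"
    and e': "(u', v') \<in> arrows M" "row M u' = i" "m \<le> row M v'"
    and im: "i < m"
    and left: "C (u, v) (real i) < C (u', v') (real i)"
  shows "C (u, v) (real m) \<le> C (u', v') (real m)"
proof (rule ccontr)
  assume "\<not> ?thesis"
  then have right: "C (u', v') (real m) < C (u, v) (real m)" by simp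
  let ?D = "\<lambda>y. C (u', v') y - C (u, v) y"
  have cont: "continuous_on {real (row M a)..real (row M b)} (C (a, b))" if "(a, b) \<in> arrows M" for a b
    using dr that unfolding drawing_def by blast
  have "continuous_on {real i..real m} (C (u, v))"
    by (rule continuous_on_subset[OF cont[OF e(1)]]) (use e in simp)
  moreover have "continuous_on {real i..real m} (C (u', v'))"
    by (rule continuous_on_subset[OF cont[OF e'(1)]]) (use e' in simp)
  ultimately have "continuous_on {real i..real m} ?D" by (intro continuous_on_diff)
  then obtain y where y: "real i \<le> y" "y \<le> real m" "?D y = 0"
    using IVT2'[of ?D "real m" 0 "real i"] left right im by auto
  have "y \<noteq> real i" "y \<noteq> real m" using y(3) left right by auto
  with y have y': "real i < y" "y < real m" by linarith+
  have ne: "(u, v) \<noteq> (u', v')" using left by blast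
  have "y \<in> {real (row M u)..real (row M v)} \<inter> {real (row M u')..real (row M v')}"
    using y(1,2) e(2,3) e'(2,3) by simp
  moreover have "C (u, v) y = C (u', v') y" using y(3) by simp
  ultimately obtain w where "w \<in> {u, v} \<inter> {u', v'}" "y = real (row M w)"
    using nc[unfolded no_crossings_def, THEN conjunct1, THEN bspec, OF e(1), unfolded prod.case,
        THEN bspec, OF e'(1), unfolded prod.case, rule_format, OF ne] by blast
  \<comment> \<open>The ends of the first arrow have depth at most \<open>i\<close> or exactly
    \<open>m\<close>, so a common end cannot lie strictly between these rows.\<close>
  then show False using y' e(2,3) e'(2,3) by auto
qed

lemma final_round_losers_placed:
  assumes lin: "linear_multibracket n M" and resp: "respectful n M"
    and line: "starting_line M (m, q, []) a"
    and final: "is_game M (i, q', [])" and im: "i < m"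
    and between: "\<And>h. i < h \<Longrightarrow> h < m \<Longrightarrow> trivial (nth_semibracket M h)"
  obtains h where "(game_round M (i, q', []), Place h) \<in> arrows M"
proof -
  let ?g = "(i, q', [])"
  let ?R = "game_round M ?g"
  obtain X C where dr: "drawing n M X C" and nc: "no_crossings n M X C"
    using resp unfolding respectful_def by blast
  have X_less: "X w < X w'" if "w \<in> flow_nodes n M" "w' \<in> flow_nodes n M" "left_of w w'" for w w'
    using dr that unfolding drawing_def by blast
  have ends: "C (w, w') (real (row M w)) = X w" "C (w, w') (real (row M w')) = X w'"
    if "(w, w') \<in> arrows M" for w w'
    using dr that unfolding drawing_def by auto
  have barrier: "C (w, w') (real h) < X (row_end M h)"
    if "(w, w') \<in> arrows M" "row M w < h" "h < row M w'" for w w' h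
    using nc that unfolding no_crossings_def by blast
  have "\<exists>u. (u, Place m) \<in> arrows M"
  proof (cases a)
    case (Seed s)
    then show ?thesis using arrows.team[of M "(m, q, [])" s] line by auto
  next
    case (Loser g)
    then have "(game_round M g, entry M (m, q, [])) \<in> arrows M"
      using line loser_line(1)[OF lin] by (intro arrows.loser) simp_all
    then show ?thesis by auto
  qed
  then obtain u where u: "(u, Place m) \<in> arrows M" by blast
  have "node_at M (m, q, []) = Some (Leaf a)" using line by (simp only: starting_line_def)
  then have m: "1 \<le> m" "m \<le> length M" by (rule node_at_height(1,2))+
  \<comment> \<open>A game at a root is in the last round, so its node is the one that carries the
    barrier of row \<open>i\<close>.\<close>
  have R: "?R \<in> flow_nodes n M" "row_end M i = ?R"
    using game_round_flow_node[OF final] is_game_bounds(3)[OF final] by (auto simp: row_end_def)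
  obtain v where v: "(?R, v) \<in> arrows M"
    using arrows.loser arrows.eliminated final by blast
  have iv: "i < row M v" using arrow_down[OF lin v] by simp
  show ?thesis
  proof (cases "row M v < m")
    case True
    show ?thesis
      using v
    proof (cases rule: arrow_target_cases[where n = n])
      case (1 h)
      then show ?thesis using that v by simp
    next
      case (2 h c)
      then have h: "i < h" "h < m" using iv True by auto
      \<comment> \<open>A trivial semibracket has no rounds, so a row strictly between
        \<open>i\<close> and \<open>m\<close> cannot contain a round node as target.\<close>
      have "nth_semibracket M h \<noteq> []"
        using nth_semibracket_nonempty[OF lin, of h] h m by simp
      then have "rounds (nth_semibracket M h) = 0"
        using between[OF h] rounds_eq_0_iff by blast
      then show ?thesis using 2 by (auto simp: flow_nodes_def)
    next
      case 3
      then show ?thesis using True m by simp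
    qed
  next
    case False
    \<comment> \<open>No game is played strictly between rows \<open>i\<close> and \<open>m\<close>,
      so the arrow into \<open>Place m\<close> must come from row \<open>i\<close> or above.\<close>
    have ui: "row M u \<le> i"
    proof (rule ccontr)
      assume later: "\<not> row M u \<le> i"
      then obtain g where g: "is_game M g" "u = game_round M g"
        using arrow_source[OF u] by auto
      have "fst g < m" "i < fst g" using arrow_down[OF lin u] later g(2) by simp_all
      then show False using between[of "fst g"] trivial_no_game g(1) by blast
    qed
    \<comment> \<open>An arrow from a higher row passes row \<open>i\<close> left of the barrier at
      \<open>?R\<close>; one that starts in row \<open>i\<close> leaves from a round no later than
      the last.\<close>
    have le: "C (u, Place m) (real i) < X ?R \<or> u = ?R"
    proof (cases "row M u = i")
      case False
      then have "row M u < i" using ui by simp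
      then show ?thesis using barrier[OF u, of i] im R(2) by simp
    next
      case True
      then obtain g where g: "is_game M g" "u = game_round M g"
        using arrow_source[OF u] is_game_bounds(1)[OF final] by auto
      have "left_of u ?R \<or> u = ?R"
        using True is_game_bounds(3)[OF final] unfolding g(2) by (cases g) auto
      moreover have "u \<in> flow_nodes n M" using g game_round_flow_node by blast
      ultimately show ?thesis using X_less[OF _ R(1)] ends(1)[OF u] True by metis
    qed
    show ?thesis
    proof (cases "u = ?R")
      case True
      then show ?thesis using that u by blast
    next
      case ne: False
      have start: "C (u, Place m) (real i) < C (?R, v) (real i)"
        using le ne ends(1)[OF v] by simp
      have "C (u, Place m) (real m) \<le> C (?R, v) (real m)"
        by (rule no_overtaking[OF dr nc u ui _ v _ _ im start]) (use False in auto)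
      then have X_le: "X (Place m) \<le> C (?R, v) (real m)" using ends(2)[OF u] by simp
      have place: "Place m \<in> flow_nodes n M" using m by (auto simp: flow_nodes_def)
      \<comment> \<open>The barrier of row \<open>m\<close> starts at or left of
        \<open>Place m\<close>. An arrow trapped to the right of \<open>Place m\<close> therefore
        cannot pass this row and has to end in it.\<close>
      have row_end_le: "X (row_end M m) \<le> X (Place m)"
      proof (cases "rounds (nth_semibracket M m) = 0")
        case True
        then show ?thesis by (simp add: row_end_def)
      next
        case False
        then have "row_end M m \<in> flow_nodes n M" using m by (auto simp: row_end_def flow_nodes_def)
        from X_less[OF this place] show ?thesis using False by (simp add: row_end_def)
      qed
      have vm: "row M v = m"
      proof (rule ccontr)
        assume "row M v \<noteq> m"
        then have "C (?R, v) (real m) < X (row_end M m)" using barrier[OF v] im False by simp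
        then show False using X_le row_end_le by simp
      qed
      show ?thesis
        using v
      proof (cases rule: arrow_target_cases[where n = n])
        case (1 h)
        then show ?thesis using that v by simp
      next
        case (2 h c)
        \<comment> \<open>A round of row \<open>m\<close> is drawn left of \<open>Place m\<close>,
          on the wrong side for the trapped arrow.\<close>
        then have "X v < X (Place m)" using X_less[of v, OF _ place] vm by simp
        then show ?thesis using X_le ends(2)[OF v] vm by simp
      next
        case 3
        then show ?thesis using vm m by simp
      qed
    qed
  qed
qed

section \<open>The two directions of the equivalence\<close>

lemma weakly_efficient_competitive:
  assumes lin: "linear_multibracket n M" and resp: "respectful n M"
    and eff: "weakly_efficient M"
    and i: "1 \<le> i" "i < m" "m \<le> length M" and nt: "\<not> trivial (nth_semibracket M i)"
  shows "competitive (nth_semibracket M m)"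
proof (rule ccontr)
  assume "\<not> competitive (nth_semibracket M m)"
  then obtain q a where "q < length (nth_semibracket M m)" "nth_semibracket M m ! q = Leaf a"
    unfolding competitive_def by (metis in_set_conv_nth)
  then have line: "starting_line M (m, q, []) a" using i by (simp add: starting_line_def)
  define k where "k = Max {h. 1 \<le> h \<and> h < m \<and> \<not> trivial (nth_semibracket M h)}"
  have fin: "finite {h. 1 \<le> h \<and> h < m \<and> \<not> trivial (nth_semibracket M h)}" by simp
  have k: "1 \<le> k" "k < m" "\<not> trivial (nth_semibracket M k)"
    using Max_in[OF fin] i nt unfolding k_def by blast+
  have between: "trivial (nth_semibracket M h)" if "k < h" "h < m" for h
  proof (rule ccontr)
    assume "\<not> ?thesis"
    then have "h \<le> k" unfolding k_def using that k(1) by (intro Max_ge[OF fin]) auto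
    with that show False by simp
  qed
  have kM: "k \<le> length M" using k i by simp
  obtain q' l r where q': "q' < length (nth_semibracket M k)"
      "nth_semibracket M k ! q' = Node l r"
    using k(3) unfolding trivial_def by (metis btree.exhaust in_set_conv_nth)
  let ?g = "(k, q', [])"
  have node: "node_at M ?g = Some (Node l r)" using q' k(1) kM by simp
  then have game: "is_game M ?g" unfolding is_game_def by blast
  obtain h where h: "(game_round M ?g, Place h) \<in> arrows M"
    using final_round_losers_placed[OF lin resp line game k(2) between] by blast
  \<comment> \<open>The arrow to \<open>Place h\<close> might stem from another game of the same
    round. Since a respectful flowchart has at most one arrow out of each node, the loser of
    \<open>?g\<close> itself must go to that place too.\<close>
  have one: "x = Place h" if "(game_round M ?g, x) \<in> arrows M" for x
    using resp h that unfolding respectful_def by blast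
  obtain v where v: "starting_line M v (Loser ?g)"
    using one[OF arrows.eliminated[OF game]] by auto
  have "entry M v = Place h" by (rule one[OF arrows.loser[OF game v]])
  then obtain h' x where vx: "v = (h', x, [])" by (cases v) (auto split: if_splits)
  obtain \<omega> s H where reach: "reaches M \<omega> s (child ?g True) H"
    using position_reachable[OF lin node_at_child[OF node]] by blast
  \<comment> \<open>Either result of \<open>?g\<close> brings the team to a root: the winner to that
    of \<open>?g\<close>, the loser to a single-leaf tree.\<close>
  have "guaranteed_ranked M \<omega> s H"
    unfolding guaranteed_ranked_def
  proof (intro allI impI)
    fix \<omega>' :: outcome
    assume "\<forall>g\<in>H. \<omega>' g = \<omega> g"
    then have r: "reaches M \<omega>' s (child ?g True) H" by (rule reaches_cong[OF reach])
    show "ranked M \<omega>' s"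
    proof (cases "\<omega>' ?g")
      case True
      then show ?thesis using reaches_root_ranked reaches.win[OF game r] by simp
    next
      case False
      then show ?thesis using reaches_root_ranked reaches.lose[OF game r _ v] vx by simp
    qed
  qed
  then show False using eff reach game unfolding weakly_efficient_def by blast
qed

lemma competitive_tail_weakly_efficient:
  assumes lin: "linear_multibracket n M"
    and triv: "\<And>i. 1 \<le> i \<Longrightarrow> i < j \<Longrightarrow> trivial (nth_semibracket M i)"
    and comp: "\<And>i. j < i \<Longrightarrow> i \<le> length M \<Longrightarrow> competitive (nth_semibracket M i)"
  shows "weakly_efficient M"
  unfolding weakly_efficient_def
proof (intro allI impI notI, elim conjE exE)
  fix \<omega> s v H g b
  assume r: "reaches M \<omega> s v H" and g: "is_game M g" "v = child g b"
    and gr: "guaranteed_ranked M \<omega> s H \<or> guaranteed_unranked M \<omega> s H"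
  have r: "reaches M \<omega> s (child g b) H" using r g by simp
  have "1 \<le> fst g" using is_game_bounds(1) g(1) by (metis prod.collapse)
  \<comment> \<open>The semibrackets before \<open>j\<close> are trivial and contain no
    games.\<close>
  then have "j \<le> fst g" using triv[of "fst g"] trivial_no_game g(1) by (meson not_le)
  then have "\<not> guaranteed_ranked M \<omega> s H"
    using can_lose_out[OF lin comp r g(1)] unfolding guaranteed_ranked_def by blast
  with gr not_guaranteed_unranked[OF lin r g(1)] show False by blast
qed

theorem theorem3p6p4:
  fixes n :: nat and M :: multibracket
  assumes "linear_multibracket n M" and "respectful n M"
  shows "weakly_efficient M \<longleftrightarrow>
    (\<exists>j. 1 \<le> j \<and> j \<le> length M \<and>
       (\<forall>i. 1 \<le> i \<and> i < j \<longrightarrow> trivial (nth_semibracket M i)) \<and>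
       (\<forall>i. j < i \<and> i \<le> length M \<longrightarrow> competitive (nth_semibracket M i)))"
proof
  assume eff: "weakly_efficient M"
  \<comment> \<open>The pivot \<open>j\<close> is the first nontrivial semibracket; admitting
    \<open>length M\<close> as a fallback makes the least index exist even when all semibrackets are
    trivial.\<close>
  let ?P = "\<lambda>i. 1 \<le> i \<and> (i = length M \<or> \<not> trivial (nth_semibracket M i))"
  have "M \<noteq> []" using assms(1) unfolding linear_multibracket_def by blast
  then have P: "?P (length M)" by (simp add: Suc_leI)
  define j where "j = (LEAST i. ?P i)"
  have j: "?P j" unfolding j_def using P by (rule LeastI)
  have "j \<le> length M" unfolding j_def using P by (rule Least_le)
  moreover have "trivial (nth_semibracket M i)" if "1 \<le> i" "i < j" for i
    using not_less_Least[of i ?P] that unfolding j_def by blast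
  \<comment> \<open>From \<open>j < i\<close> and \<open>i\<close> at most \<open>length M\<close>,
    the index \<open>j\<close> is not the fallback, so semibracket \<open>j\<close> is
    nontrivial.\<close>
  moreover have "competitive (nth_semibracket M i)" if "j < i" "i \<le> length M" for i
    using weakly_efficient_competitive[OF assms eff _ that] j that by auto
  ultimately show "\<exists>j. 1 \<le> j \<and> j \<le> length M \<and>
       (\<forall>i. 1 \<le> i \<and> i < j \<longrightarrow> trivial (nth_semibracket M i)) \<and>
       (\<forall>i. j < i \<and> i \<le> length M \<longrightarrow> competitive (nth_semibracket M i))"
    using j by blast
next
  assume "\<exists>j. 1 \<le> j \<and> j \<le> length M \<and>
       (\<forall>i. 1 \<le> i \<and> i < j \<longrightarrow> trivial (nth_semibracket M i)) \<and>
       (\<forall>i. j < i \<and> i \<le> length M \<longrightarrow> competitive (nth_semibracket M i))"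
  then obtain j where
      "\<And>i. 1 \<le> i \<Longrightarrow> i < j \<Longrightarrow> trivial (nth_semibracket M i)"
      "\<And>i. j < i \<Longrightarrow> i \<le> length M \<Longrightarrow> competitive (nth_semibracket M i)"
    by blast
  then show "weakly_efficient M" by (rule competitive_tail_weakly_efficient[OF assms(1)])
qed

end
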